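(* Let $\Lambda$ be a stationary random measure on $\mathbb{R}^d$ with $\mathbb{E}[\Lambda([0,1]^d)]=1$ which is stabilizing. Then for every $r>0$ the critical intensity satisfies $\lambda_c(r)>0$.
   Context: $\mathbb{M}$ denotes the space of locally finite Borel measures on $\mathbb{R}^d$ with the evaluation $\sigma$-algebra; $\Lambda$ is a random element of $\mathbb{M}$ that is stationary (its law is invariant under translations). For $\lambda>0$, $X^\lambda$ is the Cox process directed by $\lambda\Lambda$: conditionally on $\Lambda$, a Poisson point process with intensity measure $\lambda\Lambda$. For a locally finite set $\varphi\subset\mathbb{R}^d$ and $r>0$, the Gilbert graph $g_r(\varphi)$ has vertex set $\varphi$ and an edge between $x\neq y$ iff $|x-y|<r$; it percolates if it has an infinite connected component. $\lambda_c(r)=\inf\{\lambda>0:\ \mathbb{P}(g_r(X^\lambda)\text{ percolates})>0\}$. Notation: $Q_n(x)=x+[-n/2,n/2]^d$, $Q_n=Q_n(o)$; $\Lambda_B$ is the restriction of $\Lambda$ to $B$; ${\rm dist}(\varphi,\psi)=\inf\{|x-y|:x\in\varphi,y\in\psi\}$. Stabilizing: there is a random field $R=\{R_x\}_{x\in\mathbb{R}^d}$ on the same probability space as $\Lambda$ such that (i) $(\Lambda,R)$ are jointly stationary; (ii) $\lim_{n\to\infty}\mathbb{P}(\sup_{y\in Q_n\cap\mathbb{Q}^d}R_y<n)=1$; (iii) for all $n\ge1$, all bounded measurable $f:\mathbb{M}\to[0,\infty)$ and all finite $\varphi\subset\mathbb{R}^d$ with ${\rm dist}(x,\varphi\setminus\{x\})>3n$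 for all $x\in\varphi$, the random variables $\{f(\Lambda_{Q_n(x)})\mathbbm{1}\{\sup_{y\in Q_n(x)\cap\mathbb{Q}^d}R_y<n\}\}_{x\in\varphi}$ are independent. *)

theory Defs
  imports "HOL-Probability.Probability"
begin

section \<open>Locally finite Borel measures and the evaluation sigma-algebra\<close>

definition lf_measures :: "('a::euclidean_space) measure set" where
  "lf_measures = {\<mu>. sets \<mu> = sets borel \<and> (\<forall>B. bounded B \<longrightarrow> emeasure \<mu> B < \<infinity>)}"

text \<open>The space of locally finite Borel measures with the evaluation sigma-algebra
  (generated by the maps mu to mu(B), B Borel).\<close>
definition LFM :: "('a::euclidean_space) measure measure" where
  "LFM = sigma lf_measures
     {{\<mu> \<in> lf_measures. emeasure \<mu> B \<in> S} | B S. B \<in> sets borel \<and> S \<in> sets (borel :: ennreal measure)}"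

text \<open>Translation: (translate y mu)(B) = mu(B + y).\<close>
definition translate_measure :: "'a::euclidean_space \<Rightarrow> 'a measure \<Rightarrow> 'a measure" where
  "translate_measure y \<mu> = distr \<mu> borel (\<lambda>x. x - y)"

text \<open>Restriction Lambda_B of a measure to B: A maps to mu(A \<inter> B).\<close>
definition restr_measure :: "'a::euclidean_space measure \<Rightarrow> 'a set \<Rightarrow> 'a measure" where
  "restr_measure \<mu> B = density \<mu> (indicator B)"

definition stationary_rm :: "'w measure \<Rightarrow> ('w \<Rightarrow> ('a::euclidean_space) measure) \<Rightarrow> bool" where
  "stationary_rm M \<Lambda> \<longleftrightarrow>
     (\<forall>y. distr M LFM (\<lambda>\<omega>. translate_measure y (\<Lambda> \<omega>)) = distr M LFM \<Lambda>)"

section \<open>Cubes and rational points in R^d\<close>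

definition cube :: "real \<Rightarrow> real^'d \<Rightarrow> (real^'d) set" where
  "cube n x = {z. \<forall>i. \<bar>z $ i - x $ i\<bar> \<le> n / 2}"

definition unit_cube :: "(real^'d) set" where
  "unit_cube = {z. \<forall>i. 0 \<le> z $ i \<and> z $ i \<le> 1}"

definition rat_points :: "(real^'d) set" where
  "rat_points = {y. \<forall>i. y $ i \<in> \<rat>}"

text \<open>sup over y in B \<inter> Q^d of R_y (in the extended reals).\<close>
definition Rsup :: "(real^'d \<Rightarrow> 'w \<Rightarrow> real) \<Rightarrow> (real^'d) set \<Rightarrow> 'w \<Rightarrow> ereal" where
  "Rsup R B \<omega> = (SUP y \<in> B \<inter> rat_points. ereal (R y \<omega>))"

section \<open>Stabilization\<close>

definition stabilizing ::
  "'w measure \<Rightarrow> ('w \<Rightarrow> (real^'d) measure) \<Rightarrow> (real^'d \<Rightarrow> 'w \<Rightarrow> real) \<Rightarrow> bool" where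
  "stabilizing M \<Lambda> R \<longleftrightarrow>
     (\<forall>y. R y \<in> borel_measurable M) \<and>
     \<comment> \<open>(i) joint stationarity of (Lambda, R)\<close>
     (\<forall>y. distr M (LFM \<Otimes>\<^sub>M (\<Pi>\<^sub>M x\<in>UNIV. borel))
            (\<lambda>\<omega>. (translate_measure y (\<Lambda> \<omega>), \<lambda>x. R (x + y) \<omega>))
        = distr M (LFM \<Otimes>\<^sub>M (\<Pi>\<^sub>M x\<in>UNIV. borel)) (\<lambda>\<omega>. (\<Lambda> \<omega>, \<lambda>x. R x \<omega>))) \<and>
     \<comment> \<open>(ii)\<close>
     ((\<lambda>n::nat. measure M {\<omega> \<in> space M. Rsup R (cube (real n) 0) \<omega> < ereal (real n)})
        \<longlonglongrightarrow> 1) \<and>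
     \<comment> \<open>(iii)\<close>
     (\<forall>n::nat. n \<ge> 1 \<longrightarrow>
       (\<forall>f \<phi>. f \<in> borel_measurable LFM \<and> (\<forall>\<mu>\<in>space LFM. 0 \<le> f \<mu>) \<and>
              (\<exists>c. \<forall>\<mu>\<in>space LFM. f \<mu> \<le> c) \<and>
              finite \<phi> \<and> (\<forall>x\<in>\<phi>. \<forall>y\<in>\<phi>. x \<noteq> y \<longrightarrow> dist x y > 3 * real n) \<longrightarrow>
          prob_space.indep_vars M (\<lambda>_. borel)
            (\<lambda>x \<omega>. f (restr_measure (\<Lambda> \<omega>) (cube (real n) x)) *
                    indicator {\<omega>. Rsup R (cube (real n) x) \<omega> < ereal (real n)} \<omega> :: real)
            \<phi>))"

section \<open>Point configurations (with multiplicities), Cox processes\<close>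

text \<open>A point configuration is given by its multiplicity function phi : R^d \<Rightarrow> nat;
  its points are {x. phi x > 0}; number of points in B counted with multiplicity.\<close>
definition pcount :: "('a \<Rightarrow> nat) \<Rightarrow> 'a set \<Rightarrow> nat" where
  "pcount \<phi> B = (\<Sum>x\<in>{x\<in>B. \<phi> x > 0}. \<phi> x)"

definition poisson_weight :: "real \<Rightarrow> nat \<Rightarrow> real" where
  "poisson_weight a k = exp (- a) * a ^ k / fact k"

text \<open>X is a Cox process directed by l * Lambda: conditionally on Lambda (i.e. on the
  sigma-algebra generated by Lambda) it is a Poisson process with intensity measure l * Lambda.\<close>
definition cox_process ::
  "'w measure \<Rightarrow> ('w \<Rightarrow> ('a::euclidean_space) measure) \<Rightarrow> real \<Rightarrow> ('w \<Rightarrow> 'a \<Rightarrow> nat) \<Rightarrow> bool" where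
  "cox_process M \<Lambda> l X \<longleftrightarrow>
     (\<forall>\<omega>\<in>space M. \<forall>B. bounded B \<longrightarrow> finite {x\<in>B. X \<omega> x > 0}) \<and>
     (\<forall>B. B \<in> sets borel \<and> bounded B \<longrightarrow>
          (\<lambda>\<omega>. pcount (X \<omega>) B) \<in> measurable M (count_space (UNIV :: nat set))) \<and>
     (\<forall>(k::nat) (B :: nat \<Rightarrow> 'a set) (n :: nat \<Rightarrow> nat) A. (\<forall>i<k. B i \<in> sets borel \<and> bounded (B i)) \<and>
                (\<forall>i<k. \<forall>j<k. i \<noteq> j \<longrightarrow> B i \<inter> B j = {}) \<and> A \<in> sets LFM \<longrightarrow>
        measure M {\<omega> \<in> space M. \<Lambda> \<omega> \<in> A \<and> (\<forall>i<k. pcount (X \<omega>) (B i) = n i)}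
        = (\<integral>\<omega>. indicator A (\<Lambda> \<omega>) *
                 (\<Prod>i<k. poisson_weight (l * measure (\<Lambda> \<omega>) (B i)) (n i)) \<partial>M))"

section \<open>Gilbert graph, percolation, critical intensity\<close>

definition gilbert_edges :: "'a::metric_space set \<Rightarrow> real \<Rightarrow> ('a \<times> 'a) set" where
  "gilbert_edges V r = {(x, y). x \<in> V \<and> y \<in> V \<and> x \<noteq> y \<and> dist x y < r}"

text \<open>g_r(V) percolates iff it has an infinite connected component.\<close>
definition percolates :: "'a::metric_space set \<Rightarrow> real \<Rightarrow> bool" where
  "percolates V r \<longleftrightarrow> (\<exists>x\<in>V. infinite (((gilbert_edges V r)\<^sup>*) `` {x}))"

text \<open>lambda_c(r) = inf of lambda > 0 with P(g_r(X^lambda) percolates) > 0 (inf of the empty set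
  is +infinity).  The law of the Cox process is determined by the law of Lambda, so it does
  not matter which Cox process on M is used.\<close>
definition critical_intensity ::
  "'w measure \<Rightarrow> ('w \<Rightarrow> ('a::euclidean_space) measure) \<Rightarrow> real \<Rightarrow> ereal" where
  "critical_intensity M \<Lambda> r = Inf {ereal l | l. l > 0 \<and>
      (\<exists>X. cox_process M \<Lambda> l X \<and>
           measure M {\<omega> \<in> space M. percolates {x. X \<omega> x > 0} r} > 0)}"

end

theory Submission
  imports Defs
begin

text \<open>Cover \<open>\<real>\<^sup>d\<close> by cubes of side \<open>n \<ge> r\<close> centred at the lattice \<open>n \<int>\<^sup>d\<close>.  If the Gilbert graph
  percolates, then from some cell there are self-avoiding *-connected lattice paths of every
  length through cells containing points of the Cox process.  Among \<open>m\<close> cells there are at least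
  \<open>m / 4\<^sup>d\<close> that are pairwise far apart.  Given \<open>\<Lambda>\<close>, those are all occupied with probability
  \<open>\<Prod> (1 - exp (- l \<Lambda>(Q)))\<close>, which is at most \<open>\<Prod> (1 - exp (- l \<Lambda>(Q)) 1{Q good})\<close>, where \<open>Q\<close> is
  good if the supremum of \<open>R\<close> over its rational points is below \<open>n\<close>.  By stabilization the latter
  factors are independent, and their common mean is as small as desired once \<open>n\<close> is large and
  then \<open>l\<close> is small.  This beats the exponential number of paths.\<close>

section \<open>Measurability on the space of locally finite measures\<close>

lemma space_LFM: "space LFM = lf_measures"
  unfolding LFM_def by (rule space_measure_of) auto

lemma borel_measurable_emeasure_LFM [measurable]:
  assumes "B \<in> sets borel"
  shows "(\<lambda>\<mu>. emeasure \<mu> B) \<in> borel_measurable LFM"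
proof (rule measurableI)
  fix S :: "ennreal set" assume "S \<in> sets borel"
  then have "{\<mu> \<in> lf_measures. emeasure \<mu> B \<in> S} \<in> sets LFM"
    unfolding LFM_def using assms by (subst sets_measure_of) (auto intro!: sigma_sets.Basic)
  then show "(\<lambda>\<mu>. emeasure \<mu> B) -` S \<inter> space LFM \<in> sets LFM"
    by (simp add: space_LFM vimage_def Collect_conj_eq Int_commute)
qed simp

lemma borel_measurable_measure_LFM:
  assumes "B \<in> sets borel"
  shows "(\<lambda>\<mu>. measure \<mu> B) \<in> borel_measurable LFM"
  unfolding measure_def using borel_measurable_emeasure_LFM[OF assms] by measurable

lemma lf_measures_sets:
  assumes "\<mu> \<in> lf_measures"
  shows "sets \<mu> = sets borel" "space \<mu> = UNIV"
  using assms sets_eq_imp_space_eq[of \<mu> borel] by (auto simp: lf_measures_def)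

lemma emeasure_translate:
  assumes "\<mu> \<in> lf_measures" "B \<in> sets borel"
  shows "emeasure (translate_measure y \<mu>) B = emeasure \<mu> ((+) y ` B)"
proof -
  have "(\<lambda>x. x - y) -` B \<inter> space \<mu> = (+) y ` B"
    by (auto simp: lf_measures_sets(2)[OF assms(1)] image_iff) (metis add.commute diff_add_cancel)
  then show ?thesis
    unfolding translate_measure_def using assms lf_measures_sets(1)[OF assms(1)]
    by (subst emeasure_distr) (auto simp: measurable_cong_sets[OF lf_measures_sets(1)[OF assms(1)] refl])
qed

lemma borel_translation: "(B :: 'a::euclidean_space set) \<in> sets borel \<Longrightarrow> (+) y ` B \<in> sets borel"
proof -
  assume "B \<in> sets borel"
  then have "(\<lambda>x. x - y) -` B \<inter> space borel \<in> sets borel"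
    by (intro measurable_sets[where A=borel]) auto
  moreover have "(\<lambda>x. x - y) -` B \<inter> space borel = (+) y ` B"
    by (auto simp: image_iff) (metis add.commute diff_add_cancel)
  ultimately show ?thesis by simp
qed

lemma translate_measure_lf:
  assumes "\<mu> \<in> lf_measures"
  shows "translate_measure y \<mu> \<in> lf_measures"
proof -
  have "emeasure (translate_measure y \<mu>) B < \<infinity>" if "bounded B" for B
  proof (cases "B \<in> sets borel")
    case True
    then show ?thesis
      using assms bounded_translation[OF that, of y] by (simp add: emeasure_translate lf_measures_def)
  next
    \<comment> \<open>\<open>lf_measures\<close> quantifies over all bounded sets, Borel or not;
      outside the sigma-algebra \<open>emeasure\<close> is 0 by convention.\<close>
    case False
    then show ?thesis by (simp add: emeasure_notin_sets translate_measure_def)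
  qed
  then show ?thesis by (auto simp: lf_measures_def translate_measure_def)
qed

text \<open>Evaluation sets generate \<open>LFM\<close>, and the preimage of one under a translation
  is the evaluation set of the shifted Borel set.\<close>

lemma translate_measure_measurable: "translate_measure y \<in> measurable LFM LFM"
proof (rule measurable_sigma_sets)
  show "sets LFM = sigma_sets lf_measures
     {{\<mu> \<in> lf_measures. emeasure \<mu> B \<in> S} | B S. B \<in> sets borel \<and> S \<in> sets borel}"
    unfolding LFM_def by (rule sets_measure_of) auto
next
  fix A :: "'a measure set"
  assume "A \<in> {{\<mu> \<in> lf_measures. emeasure \<mu> B \<in> S} | B S. B \<in> sets borel \<and> S \<in> sets borel}"
  then obtain B S where A: "A = {\<mu> \<in> lf_measures. emeasure \<mu> B \<in> S}"
    and B: "B \<in> sets borel" and S: "S \<in> sets borel" by auto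
  have "translate_measure y -` A \<inter> space LFM = (\<lambda>\<mu>. emeasure \<mu> ((+) y ` B)) -` S \<inter> space LFM"
    using B by (auto simp: A space_LFM emeasure_translate translate_measure_lf)
  also have "\<dots> \<in> sets LFM"
    by (rule measurable_sets[OF borel_measurable_emeasure_LFM[OF borel_translation[OF B]] S])
  finally show "translate_measure y -` A \<inter> space LFM \<in> sets LFM" .
qed (auto simp: space_LFM translate_measure_lf)

text \<open>Condition (iii) of stabilization only admits functions of the restricted measure; the
  mass of a cube is recovered from it as a total mass.\<close>

lemma measure_restr:
  assumes "\<mu> \<in> lf_measures" "B \<in> sets borel"
  shows "measure (restr_measure \<mu> B) UNIV = measure \<mu> B"
  using assms lf_measures_sets[OF assms(1)]
  unfolding restr_measure_def measure_def by (subst emeasure_density) auto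

section \<open>Occupation probabilities of a Cox process\<close>

text \<open>\<open>cox_process\<close> indexes its sets by an initial segment of the naturals, so a
  bijection \<open>h\<close> carries the formula over to any finite index set. With all counts 0
  only the exponential factors remain, and the event \<open>A\<close> is all of
  \<open>space LFM\<close>.\<close>

lemma (in prob_space) cox_void_probability:
  assumes L: "\<Lambda> \<in> measurable M LFM" and cox: "cox_process M \<Lambda> l X" and "finite S"
    and B: "\<And>i. i \<in> S \<Longrightarrow> B i \<in> sets borel \<and> bounded (B i)"
    and disj: "disjoint_family_on B S"
  shows "prob {\<omega> \<in> space M. \<forall>i\<in>S. pcount (X \<omega>) (B i) = 0}
    = (\<integral>\<omega>. (\<Prod>i\<in>S. exp (- (l * measure (\<Lambda> \<omega>) (B i)))) \<partial>M)"
proof -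
  obtain h where h: "bij_betw h {..<card S} S"
    using ex_bij_betw_nat_finite[OF \<open>finite S\<close>] by (auto simp: atLeast0LessThan)
  then have inj: "inj_on h {..<card S}" and im: "h ` {..<card S} = S"
    by (auto simp: bij_betw_def)
  have hS: "h i \<in> S" if "i < card S" for i using that im by auto
  have all: "(\<forall>i\<in>S. P i) \<longleftrightarrow> (\<forall>i<card S. P (h i))" for P
    by (subst im[symmetric]) auto
  have disj': "\<forall>i<card S. \<forall>j<card S. i \<noteq> j \<longrightarrow> B (h i) \<inter> B (h j) = {}"
  proof (intro allI impI)
    fix i j assume ij: "i < card S" "j < card S" "i \<noteq> j"
    then have "h i \<noteq> h j" using inj_onD[OF inj, of i j] by auto
    then show "B (h i) \<inter> B (h j) = {}"
      using disjoint_family_onD[OF disj] hS ij by blast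
  qed
  have "prob {\<omega> \<in> space M. \<Lambda> \<omega> \<in> space LFM \<and> (\<forall>i<card S. pcount (X \<omega>) (B (h i)) = 0)}
      = (\<integral>\<omega>. indicator (space LFM) (\<Lambda> \<omega>) *
          (\<Prod>i<card S. poisson_weight (l * measure (\<Lambda> \<omega>) (B (h i))) 0) \<partial>M)"
    by (rule cox[unfolded cox_process_def, THEN conjunct2, THEN conjunct2, rule_format,
          where n="\<lambda>_. 0"]) (intro conjI allI impI sets.top; use B hS disj' in blast)
  also have "\<dots> = (\<integral>\<omega>. (\<Prod>i\<in>S. exp (- (l * measure (\<Lambda> \<omega>) (B i)))) \<partial>M)"
    using measurable_space[OF L]
    by (intro Bochner_Integration.integral_cong refl)
       (simp add: poisson_weight_def prod.reindex_bij_betw[OF h, of "\<lambda>i. exp (- (l * measure (\<Lambda> _) (B i)))"])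
  also have "{\<omega> \<in> space M. \<Lambda> \<omega> \<in> space LFM \<and> (\<forall>i<card S. pcount (X \<omega>) (B (h i)) = 0)}
      = {\<omega> \<in> space M. \<forall>i\<in>S. pcount (X \<omega>) (B i) = 0}"
    using measurable_space[OF L] unfolding all by auto
  finally show ?thesis .
qed

text \<open>Induction on the sets required to be occupied: asking for one more is a difference of
  two events with fewer occupied sets, one of which has an additional void set. This is why a family
  \<open>S\<close> of void sets is carried along and kept arbitrary.\<close>

lemma (in prob_space) cox_occupation_probability:
  assumes L: "\<Lambda> \<in> measurable M LFM" and cox: "cox_process M \<Lambda> l X" and l: "l \<ge> 0"
    and "finite S" "finite T" "S \<inter> T = {}"
    and B: "\<And>i. i \<in> S \<union> T \<Longrightarrow> B i \<in> sets borel \<and> bounded (B i)"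
    and disj: "disjoint_family_on B (S \<union> T)"
  shows "prob {\<omega> \<in> space M. (\<forall>i\<in>S. pcount (X \<omega>) (B i) = 0) \<and> (\<forall>i\<in>T. pcount (X \<omega>) (B i) \<noteq> 0)}
    = (\<integral>\<omega>. (\<Prod>i\<in>S. exp (- (l * measure (\<Lambda> \<omega>) (B i)))) *
            (\<Prod>i\<in>T. 1 - exp (- (l * measure (\<Lambda> \<omega>) (B i)))) \<partial>M)"
  using \<open>finite T\<close> assms(4,6-)
proof (induction T arbitrary: S rule: finite_induct)
  case empty
  then show ?case using cox_void_probability[OF L cox, of S B] by simp
next
  case (insert j T)
  let ?e = "\<lambda>\<omega> i. exp (- (l * measure (\<Lambda> \<omega>) (B i)))"
  let ?E = "\<lambda>S T. {\<omega> \<in> space M. (\<forall>i\<in>S. pcount (X \<omega>) (B i) = 0) \<and> (\<forall>i\<in>T. pcount (X \<omega>) (B i) \<noteq> 0)}"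
  let ?F = "\<lambda>S T \<omega>. (\<Prod>i\<in>S. ?e \<omega> i) * (\<Prod>i\<in>T. 1 - ?e \<omega> i)"
  have N: "(\<lambda>\<omega>. pcount (X \<omega>) (B i)) \<in> measurable M (count_space UNIV)" if "i \<in> S \<union> insert j T" for i
    using cox insert.prems(3)[OF that] unfolding cox_process_def by auto
  have meas: "?E S' T' \<in> events" if "S' \<subseteq> S \<union> insert j T" "T' \<subseteq> S \<union> insert j T" "finite S'" "finite T'" for S' T'
  proof -
    have *: "{\<omega> \<in> space M. pcount (X \<omega>) (B i) = 0} \<in> events"
      "{\<omega> \<in> space M. pcount (X \<omega>) (B i) \<noteq> 0} \<in> events" if "i \<in> S' \<union> T'" for i
    proof -
      have [measurable]: "(\<lambda>\<omega>. pcount (X \<omega>) (B i)) \<in> measurable M (count_space UNIV)"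
        using N[of i] that \<open>S' \<subseteq> _\<close> \<open>T' \<subseteq> _\<close> by blast
      show "{\<omega> \<in> space M. pcount (X \<omega>) (B i) = 0} \<in> events"
        "{\<omega> \<in> space M. pcount (X \<omega>) (B i) \<noteq> 0} \<in> events" by measurable
    qed
    show ?thesis
      using that(3,4) by (intro sets.sets_Collect_conj sets.sets_Collect_finite_All *) auto
  qed
  have int: "integrable M (?F S' T')" if "S' \<subseteq> S \<union> insert j T" "T' \<subseteq> S \<union> insert j T" for S' T'
  proof (rule integrable_const_bound[where B=1])
    have [measurable]: "(\<lambda>\<omega>. measure (\<Lambda> \<omega>) (B i)) \<in> borel_measurable M" if "i \<in> S' \<union> T'" for i
    proof -
      have "B i \<in> sets borel"
        using insert.prems(3)[of i] that \<open>S' \<subseteq> _\<close> \<open>T' \<subseteq> _\<close> by blast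
      then show ?thesis using measurable_compose[OF L borel_measurable_measure_LFM] by blast
    qed
    show "?F S' T' \<in> borel_measurable M" by measurable
    have "0 \<le> ?e \<omega> i \<and> ?e \<omega> i \<le> 1" for \<omega> i using l by simp
    then have "\<bar>?F S' T' \<omega>\<bar> \<le> 1" for \<omega>
      unfolding abs_mult abs_prod
      by (intro mult_le_one prod_le_1 prod_nonneg abs_ge_zero ballI conjI) (auto simp: abs_le_iff)
    then show "AE \<omega> in M. norm (?F S' T' \<omega>) \<le> 1" by simp
  qed
  have "?E S (insert j T) = ?E S T - ?E (insert j S) T" by auto
  then have "prob (?E S (insert j T)) = prob (?E S T - ?E (insert j S) T)" by (rule arg_cong)
  also have "\<dots> = prob (?E S T) - prob (?E (insert j S) T)"
    using insert.hyps(1) insert.prems(1) by (intro finite_measure_Diff meas) auto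
  also have "prob (?E S T) = (\<integral>\<omega>. ?F S T \<omega> \<partial>M)"
    using insert.prems disjoint_family_on_mono[OF _ insert.prems(4), of "S \<union> T"]
    by (intro insert.IH) blast+
  also have "prob (?E (insert j S) T) = (\<integral>\<omega>. ?F (insert j S) T \<omega> \<partial>M)"
    using insert.prems insert.hyps(2) by (intro insert.IH) auto
  also have "(\<integral>\<omega>. ?F S T \<omega> \<partial>M) - (\<integral>\<omega>. ?F (insert j S) T \<omega> \<partial>M) = (\<integral>\<omega>. ?F S T \<omega> - ?F (insert j S) T \<omega> \<partial>M)"
    by (rule Bochner_Integration.integral_diff[symmetric]; rule int) auto
  also have "\<dots> = (\<integral>\<omega>. ?F S (insert j T) \<omega> \<partial>M)"
  proof -
    have "j \<notin> S" using insert.prems(2) by blast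
    then have "?F S T \<omega> - ?F (insert j S) T \<omega> = ?F S (insert j T) \<omega>" for \<omega>
      unfolding prod.insert[OF insert.hyps] prod.insert[OF insert.prems(1) \<open>j \<notin> S\<close>]
      by (simp only: algebra_simps)
    then show ?thesis by (simp only:)
  qed
  finally show ?case .
qed


section \<open>Lattice paths\<close>

text \<open>Finite degrees make every ball around \<open>z\<close> finite, so an infinite component
  has a vertex \<open>b\<close> at distance \<open>k > m\<close>. A shortest path to
  \<open>b\<close> has no repetitions, and its first \<open>m\<close> steps are as required.\<close>

lemma exists_self_avoiding_path:
  assumes fin: "\<And>a. finite (E `` {a})" and inf: "infinite (E\<^sup>* `` {z})"
  shows "\<exists>w. w 0 = z \<and> (\<forall>i<m. (w i, w (Suc i)) \<in> E) \<and> inj_on w {..m}"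
proof -
  have fin_pow: "finite ((E ^^ k) `` {z})" for k
  proof (induction k)
    case (Suc k)
    have "(E ^^ Suc k) `` {z} = (\<Union>a\<in>(E ^^ k) `` {z}. E `` {a})" by auto
    then show ?case using Suc fin by simp
  qed simp
  then have "finite (\<Union>k\<le>m. (E ^^ k) `` {z})" by simp
  then obtain b where b: "(z, b) \<in> E\<^sup>*" "\<And>k. k \<le> m \<Longrightarrow> (z, b) \<notin> E ^^ k"
    using inf finite_subset[of "E\<^sup>* `` {z}" "\<Union>k\<le>m. (E ^^ k) `` {z}"] by blast
  define k where "k = (LEAST k. (z, b) \<in> E ^^ k)"
  have k: "(z, b) \<in> E ^^ k" and least: "\<And>j. (z, b) \<in> E ^^ j \<Longrightarrow> k \<le> j"
    using b(1) LeastI_ex[of "\<lambda>k. (z, b) \<in> E ^^ k"] unfolding rtrancl_power k_def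
    by (auto intro: Least_le)
  then have "m < k" using b(2) by (meson not_le)
  obtain w where w: "w 0 = z" "w k = b" "\<And>i. i < k \<Longrightarrow> (w i, w (Suc i)) \<in> E"
    using k unfolding relpow_fun_conv by blast
  have reach: "(z, w i) \<in> E ^^ i" "(w i, b) \<in> E ^^ (k - i)" if "i \<le> k" for i
  proof -
    show "(z, w i) \<in> E ^^ i"
      unfolding relpow_fun_conv using w that by (intro exI[of _ w]) auto
    show "(w i, b) \<in> E ^^ (k - i)"
      unfolding relpow_fun_conv using w that by (intro exI[of _ "\<lambda>j. w (i + j)"]) auto
  qed
  have "w i \<noteq> w j" if "i < j" "j \<le> m" for i j
  proof
    \<comment> \<open>Cutting out the loop between \<open>i\<close> and \<open>j\<close> would give
      a path to \<open>b\<close> of length less than \<open>k\<close>.\<close>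
    assume "w i = w j"
    then have "(z, b) \<in> E ^^ (i + (k - j))"
      using reach[of i] reach[of j] that \<open>m < k\<close> unfolding relpow_add by auto
    then show False using least[of "i + (k - j)"] that \<open>m < k\<close> by simp
  qed
  then have "inj_on w {..m}"
    by (metis atMost_iff inj_onI linorder_neqE_nat)
  then show ?thesis using w \<open>m < k\<close> by (intro exI[of _ w]) auto
qed

lemma finite_int_vectors:
  assumes "finite A"
  shows "finite {u :: int^'d. \<forall>i. u $ i \<in> A}"
proof (rule finite_subset)
  show "{u :: int^'d. \<forall>i. u $ i \<in> A} \<subseteq> vec_lambda ` (\<Pi>\<^sub>E i\<in>UNIV. A)"
  proof
    fix u :: "int^'d" assume "u \<in> {u. \<forall>i. u $ i \<in> A}"
    then show "u \<in> vec_lambda ` (\<Pi>\<^sub>E i\<in>UNIV. A)"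
      by (intro image_eqI[where x="vec_nth u"]) (auto simp: PiE_iff)
  qed
  show "finite (vec_lambda ` (\<Pi>\<^sub>E i\<in>(UNIV :: 'd set). A))"
    by (intro finite_imageI finite_PiE assms) auto
qed

text \<open>The zero vector is included because adjacent points of the Gilbert graph may lie in the
  same cell.\<close>

definition steps :: "(int^'d) set" where
  "steps = {u. \<forall>i. u $ i \<in> {-1..1}}"

lemma finite_steps: "finite (steps :: (int^'d) set)"
  unfolding steps_def by (rule finite_int_vectors) simp

lemma card_steps_pos: "card (steps :: (int^'d) set) > 0"
proof -
  have "(0 :: int^'d) \<in> steps" by (simp add: steps_def)
  then show ?thesis using finite_steps card_gt_0_iff by blast
qed

text \<open>Only the set of visited sites is kept, since whether all of them are occupied does not
  depend on the order of the visits.\<close>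

definition saw_sets :: "int^'d \<Rightarrow> nat \<Rightarrow> (int^'d) set set" where
  "saw_sets z m = {w ` {..m} | w. w 0 = z \<and> (\<forall>i<m. w (Suc i) - w i \<in> steps) \<and> inj_on w {..m}}"

text \<open>A walk is determined by its start and the list of its \<open>m\<close> increments, so
  counting such lists bounds the number of paths.\<close>

lemma saw_sets_subset:
  "saw_sets z m \<subseteq>
     (\<lambda>us. (\<lambda>i. z + sum_list (take i us)) ` {..m}) ` {us. set us \<subseteq> steps \<and> length us = m}"
proof
  fix S assume "S \<in> saw_sets z m"
  then obtain w where w: "S = w ` {..m}" "w 0 = z" "\<And>i. i < m \<Longrightarrow> w (Suc i) - w i \<in> steps"
    unfolding saw_sets_def by auto
  let ?us = "map (\<lambda>i. w (Suc i) - w i) [0..<m]"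
  have "w i = z + sum_list (take i ?us)" if "i \<le> m" for i
    using that
  proof (induction i)
    case (Suc i)
    then show ?case by (simp add: take_Suc_conv_app_nth)
  qed (simp add: w)
  then have "S = (\<lambda>i. z + sum_list (take i ?us)) ` {..m}" unfolding w by (intro image_cong) auto
  then show "S \<in> (\<lambda>us. (\<lambda>i. z + sum_list (take i us)) ` {..m}) ` {us. set us \<subseteq> steps \<and> length us = m}"
    using w(3) by (intro image_eqI[where x="?us"]) auto
qed

lemma finite_saw_sets: "finite (saw_sets z m)"
  by (rule finite_subset[OF saw_sets_subset]) (intro finite_imageI finite_lists_length_eq finite_steps)

lemma card_saw_sets: "card (saw_sets (z :: int^'d) m) \<le> card (steps :: (int^'d) set) ^ m"
proof -
  let ?L = "{us. set us \<subseteq> steps \<and> length us = m} :: (int^'d) list set"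
  have "card (saw_sets z m) \<le> card ((\<lambda>us. (\<lambda>i. z + sum_list (take i us)) ` {..m}) ` ?L)"
    by (intro card_mono saw_sets_subset finite_imageI finite_lists_length_eq finite_steps)
  also have "\<dots> \<le> card ?L"
    by (intro card_image_le finite_lists_length_eq finite_steps)
  finally show ?thesis by (simp add: card_lists_length_eq finite_steps)
qed

lemma saw_sets_card:
  assumes "S \<in> saw_sets z m"
  shows "finite S" "card S = Suc m"
  using assms unfolding saw_sets_def by (auto simp: card_image)

text \<open>Representatives modulo 4. Distinct sites of one class differ by at least 4 in some
  coordinate, which puts the centres of their cells more than \<open>3 * n\<close> apart; modulus 3
  would miss the strict inequality in condition (iii).\<close>

definition residue_classes :: "(int^'d) set" where
  "residue_classes = {u. \<forall>i. u $ i \<in> {0..3}}"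

lemma finite_residue_classes: "finite (residue_classes :: (int^'d) set)"
  unfolding residue_classes_def by (rule finite_int_vectors) simp

text \<open>Pigeonhole on the residue classes modulo 4.\<close>
lemma exists_separated_subset:
  fixes S :: "(int^'d) set"
  assumes "finite S"
  obtains T where "T \<subseteq> S" "card S \<le> card (residue_classes :: (int^'d) set) * card T"
    "\<And>x y. x \<in> T \<Longrightarrow> y \<in> T \<Longrightarrow> x \<noteq> y \<Longrightarrow> \<exists>i. \<bar>x $ i - y $ i\<bar> \<ge> 4"
proof -
  let ?C = "residue_classes :: (int^'d) set"
  define c where "c x = (\<chi> i. x $ i mod 4)" for x :: "int^'d"
  define N where "N = Max ((\<lambda>k. card {x \<in> S. c x = k}) ` ?C)"
  have ne: "?C \<noteq> {}" by (auto simp: residue_classes_def intro!: exI[of _ 0])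
  have "N \<in> (\<lambda>k. card {x \<in> S. c x = k}) ` ?C"
    unfolding N_def using ne finite_residue_classes by (intro Max_in) auto
  then obtain k where k: "card {x \<in> S. c x = k} = N" by auto
  have cC: "c x \<in> ?C" for x
  proof -
    have "0 \<le> (x $ i) mod 4 \<and> (x $ i) mod 4 \<le> 3" for i by presburger
    then show ?thesis by (simp add: c_def residue_classes_def)
  qed
  then have "S = (\<Union>k\<in>?C. {x \<in> S. c x = k})" by auto
  then have "card S \<le> (\<Sum>k\<in>?C. card {x \<in> S. c x = k})"
    using card_UN_le[OF finite_residue_classes, of "\<lambda>k. {x \<in> S. c x = k}"] by simp
  also have "\<dots> \<le> card ?C * N"
    unfolding N_def using finite_residue_classes
    by (intro sum_bounded_above[where 'a=nat, simplified]) (auto intro!: Max_ge)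
  finally have 1: "card S \<le> card ?C * card {x \<in> S. c x = k}" using k by simp
  have 2: "\<exists>i. \<bar>x $ i - y $ i\<bar> \<ge> 4" if "c x = k" "c y = k" "x \<noteq> y" for x y
  proof -
    obtain i where i: "x $ i \<noteq> y $ i" using \<open>x \<noteq> y\<close> by (auto simp: vec_eq_iff)
    have "c x $ i = c y $ i" using that by simp
    then have "x $ i mod 4 = y $ i mod 4" by (simp add: c_def)
    with i have "\<bar>x $ i - y $ i\<bar> \<ge> 4" by presburger
    then show ?thesis ..
  qed
  show ?thesis by (rule that[OF _ 1]) (use 2 in auto)
qed

section \<open>From percolation to occupied lattice paths\<close>

definition site :: "nat \<Rightarrow> int^'d \<Rightarrow> real^'d" where
  "site n z = (\<chi> i. real n * of_int (z $ i))"

definition cell :: "nat \<Rightarrow> int^'d \<Rightarrow> (real^'d) set" where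
  "cell n z = cube (real n) (site n z)"

text \<open>Rounds \<open>x / n\<close> to a nearest lattice point. The closed cells share faces,
  and the floor settles which of them a point is assigned to.\<close>

definition cell_of :: "nat \<Rightarrow> real^'d \<Rightarrow> int^'d" where
  "cell_of n x = (\<chi> i. \<lfloor>x $ i / real n + 1 / 2\<rfloor>)"

lemma cube_eq_cbox: "cube n x = cbox (x - (\<chi> i. n / 2)) (x + (\<chi> i. n / 2))"
proof -
  have "\<bar>a - b\<bar> \<le> n / 2 \<longleftrightarrow> b - n / 2 \<le> a \<and> a \<le> b + n / 2" for a b :: real by linarith
  then show ?thesis by (simp add: set_eq_iff cube_def mem_box_cart)
qed

lemma cube_borel: "cube n x \<in> sets borel" and bounded_cube: "bounded (cube n x)"
  unfolding cube_eq_cbox by (auto intro: bounded_cbox)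

lemma mem_cell_of:
  assumes "n \<ge> 1"
  shows "x \<in> cell n (cell_of n x)"
proof -
  have "\<bar>x $ i - real n * of_int \<lfloor>x $ i / real n + 1 / 2\<rfloor>\<bar> \<le> real n / 2" for i
  proof -
    define t where "t = x $ i / real n"
    have x: "x $ i = real n * t" using assms by (simp add: t_def)
    have "\<bar>t - of_int \<lfloor>t + 1 / 2\<rfloor>\<bar> \<le> 1 / 2" by linarith
    then have "real n * \<bar>t - of_int \<lfloor>t + 1 / 2\<rfloor>\<bar> \<le> real n * (1 / 2)"
      by (intro mult_left_mono) auto
    then have "\<bar>real n * (t - of_int \<lfloor>t + 1 / 2\<rfloor>)\<bar> \<le> real n / 2" by (simp add: abs_mult)
    then show ?thesis using x by (simp add: t_def[symmetric] right_diff_distrib)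
  qed
  then show ?thesis by (simp add: cell_def cube_def site_def cell_of_def)
qed

text \<open>After division by \<open>n\<close> the coordinates differ by less than 1, so the floors
  differ by at most 1.\<close>

lemma cell_of_adjacent:
  assumes "n \<ge> 1" "dist x y < real n"
  shows "cell_of n y - cell_of n x \<in> steps"
proof -
  have "\<lfloor>y $ i / real n + 1 / 2\<rfloor> - \<lfloor>x $ i / real n + 1 / 2\<rfloor> \<in> {-1..1}" for i
  proof -
    have "\<bar>x $ i - y $ i\<bar> < real n"
      using component_le_norm_cart[of "x - y" i] assms(2) by (simp add: dist_norm)
    then have "\<bar>x $ i / real n - y $ i / real n\<bar> < 1"
      using assms(1) by (simp add: diff_divide_distrib[symmetric] abs_divide)
    then show ?thesis by (auto; linarith)
  qed
  then show ?thesis by (auto simp: steps_def cell_of_def)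
qed

text \<open>Edges are shorter than \<open>r \<le> n\<close>, so passing from points to cells turns
  them into steps between occupied cells. The start \<open>z\<close>, the cell of a point in the
  infinite component, serves every \<open>m\<close>.\<close>

lemma percolates_imp_occupied_saw:
  fixes V :: "(real^'d) set"
  assumes lf: "\<And>B. bounded B \<Longrightarrow> finite (V \<inter> B)" and n: "n \<ge> 1" "r \<le> real n"
    and perc: "percolates V r"
  shows "\<exists>z. \<forall>m. \<exists>S\<in>saw_sets z m. \<forall>y\<in>S. V \<inter> cell n y \<noteq> {}"
proof -
  obtain x where x: "x \<in> V" "infinite ((gilbert_edges V r)\<^sup>* `` {x})"
    using perc unfolding percolates_def by auto
  define occ where "occ y \<longleftrightarrow> V \<inter> cell n y \<noteq> {}" for y
  define E where "E = {(a, b). b - a \<in> steps \<and> occ a \<and> occ b}"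
  have occ: "occ (cell_of n y)" if "y \<in> V" for y
    using that mem_cell_of[OF n(1), of y] unfolding occ_def by auto
  have path: "(cell_of n x, cell_of n y) \<in> E\<^sup>* \<and> y \<in> V" if "(x, y) \<in> (gilbert_edges V r)\<^sup>*" for y
    using that
  proof (induction rule: rtrancl_induct)
    case (step y y')
    then have "y \<in> V" "y' \<in> V" "dist y y' < real n" using n unfolding gilbert_edges_def by auto
    then have "(cell_of n y, cell_of n y') \<in> E"
      unfolding E_def using occ cell_of_adjacent[OF n(1)] by auto
    then show ?case using step.IH \<open>y' \<in> V\<close> by auto
  qed (use x in auto)
  have inf: "infinite (E\<^sup>* `` {cell_of n x})"
  proof
    assume fin: "finite (E\<^sup>* `` {cell_of n x})"
    \<comment> \<open>Finitely many cells hold only finitely many points of \<open>V\<close>, too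
      few for the infinite component.\<close>
    have "(gilbert_edges V r)\<^sup>* `` {x} \<subseteq> (\<Union>z\<in>E\<^sup>* `` {cell_of n x}. V \<inter> cell n z)"
      using path mem_cell_of[OF n(1)] by blast
    moreover have "finite \<dots>"
      using fin lf bounded_cube unfolding cell_def by blast
    ultimately show False using x(2) finite_subset by blast
  qed
  have fin: "finite (E `` {a})" for a
    by (rule finite_subset[of _ "(+) a ` steps"])
       (auto simp: E_def image_iff finite_steps intro!: bexI[of _ "_ - a"])
  have "\<exists>w. w 0 = cell_of n x \<and> (\<forall>i<m. (w i, w (Suc i)) \<in> E) \<and> inj_on w {..m}" for m
    by (rule exists_self_avoiding_path[OF fin inf])
  moreover have "w ` {..m} \<in> saw_sets (cell_of n x) m \<and> (\<forall>y\<in>w ` {..m}. occ y)"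
    if "w 0 = cell_of n x" "\<forall>i<m. (w i, w (Suc i)) \<in> E" "inj_on w {..m}" for w m
  proof
    show "w ` {..m} \<in> saw_sets (cell_of n x) m" using that unfolding saw_sets_def E_def by auto
    have "occ (w i)" if "i \<le> m" for i
    proof (cases i)
      \<comment> \<open>Later cells are occupied as endpoints of steps in \<open>E\<close>; the
        first one contains \<open>x\<close>, which also settles \<open>m = 0\<close>.\<close>
      case 0
      then show ?thesis using occ[OF x(1)] \<open>w 0 = _\<close> by simp
    next
      case (Suc j)
      then show ?thesis using \<open>\<forall>i<m. (w i, w (Suc i)) \<in> E\<close> that unfolding E_def by auto
    qed
    then show "\<forall>y\<in>w ` {..m}. occ y" by auto
  qed
  ultimately show ?thesis unfolding occ_def by metis
qed

text \<open>The centres differ by at least \<open>4 * n\<close> in coordinate \<open>i\<close>, and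
  a cell reaches only \<open>n / 2\<close> from its centre. The distance serves condition (iii), the
  disjointness serves the Cox formula.\<close>

lemma separated_cells:
  assumes "n \<ge> 1" "\<bar>x $ i - y $ i\<bar> \<ge> 4"
  shows "dist (site n x) (site n y) > 3 * real n" "cell n x \<inter> cell n y = {}"
proof -
  have "real n * of_int \<bar>x $ i - y $ i\<bar> \<ge> real n * 4"
    using assms(2) by (intro mult_left_mono) linarith+
  then have *: "\<bar>site n x $ i - site n y $ i\<bar> \<ge> real n * 4"
    by (simp add: site_def right_diff_distrib[symmetric] abs_mult)
  then show "dist (site n x) (site n y) > 3 * real n"
    using component_le_norm_cart[of "site n x - site n y" i] assms(1) by (simp add: dist_norm)
  show "cell n x \<inter> cell n y = {}"
  proof (intro equals0I)
    fix p assume "p \<in> cell n x \<inter> cell n y"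
    then have "\<bar>p $ i - site n x $ i\<bar> \<le> real n / 2" "\<bar>p $ i - site n y $ i\<bar> \<le> real n / 2"
      unfolding cell_def cube_def by auto
    with * assms(1) show False by linarith
  qed
qed

section \<open>Good cubes\<close>

lemma countable_rat_points: "countable (rat_points :: (real^'d) set)"
proof (rule countable_subset)
  show "(rat_points :: (real^'d) set) \<subseteq> vec_lambda ` (\<Pi>\<^sub>E i\<in>UNIV. \<rat>)"
  proof
    fix u :: "real^'d" assume "u \<in> rat_points"
    then show "u \<in> vec_lambda ` (\<Pi>\<^sub>E i\<in>UNIV. \<rat>)"
      by (intro image_eqI[where x="vec_nth u"]) (auto simp: PiE_iff rat_points_def)
  qed
  show "countable (vec_lambda ` (\<Pi>\<^sub>E i\<in>(UNIV :: 'd set). (\<rat> :: real set)))"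
    by (intro countable_image countable_PiE countable_rat) auto
qed

lemma translate_cube: "(+) x ` cube n 0 = cube n x"
proof (intro equalityI subsetI)
  fix p assume "p \<in> cube n x"
  then show "p \<in> (+) x ` cube n 0"
    by (intro image_eqI[where x="p - x"]) (auto simp: cube_def)
qed (auto simp: cube_def)

text \<open>A shift by a rational vector maps \<open>rat_points\<close> onto itself, so the suprema
  of \<open>R\<close> over a cube and over its translate use matching points.\<close>

lemma translate_cube_rat_points:
  assumes "x \<in> rat_points"
  shows "(\<lambda>y. y + x) ` (cube n 0 \<inter> rat_points) = cube n x \<inter> rat_points"
proof (intro equalityI subsetI)
  fix p assume "p \<in> cube n x \<inter> rat_points"
  then have "p - x \<in> cube n 0 \<inter> rat_points"
    using assms by (auto simp: cube_def rat_points_def)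
  then show "p \<in> (\<lambda>y. y + x) ` (cube n 0 \<inter> rat_points)"
    by (intro image_eqI[where x="p - x"]) auto
qed (use assms in \<open>auto simp: cube_def rat_points_def\<close>)

lemma site_rat_points: "site n z \<in> rat_points"
  by (auto simp: site_def rat_points_def)

text \<open>Given \<open>\<Lambda>\<close>, the probability that the cube is empty, replaced by 0 if
  the cube is not good. The restricted measure appears so that this is literally a product as in
  condition (iii).\<close>

definition good_weight ::
  "('w \<Rightarrow> (real^'d) measure) \<Rightarrow> (real^'d \<Rightarrow> 'w \<Rightarrow> real) \<Rightarrow> real \<Rightarrow> nat \<Rightarrow> real^'d \<Rightarrow> 'w \<Rightarrow> real" where
  "good_weight \<Lambda> R l n x \<omega> = exp (- (l * measure (restr_measure (\<Lambda> \<omega>) (cube (real n) x)) UNIV)) *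
     indicator {\<omega>. Rsup R (cube (real n) x) \<omega> < ereal (real n)} \<omega>"

context prob_space
begin

context
  fixes \<Lambda> :: "'a \<Rightarrow> (real^'d) measure" and R :: "real^'d \<Rightarrow> 'a \<Rightarrow> real"
  assumes L: "\<Lambda> \<in> measurable M LFM" and stab: "stabilizing M \<Lambda> R"
begin

lemma Lambda_lf: "\<omega> \<in> space M \<Longrightarrow> \<Lambda> \<omega> \<in> lf_measures"
  using measurable_space[OF L] by (simp add: space_LFM)

lemma good_weight_eq:
  assumes "\<omega> \<in> space M"
  shows "good_weight \<Lambda> R l n x \<omega> = exp (- (l * measure (\<Lambda> \<omega>) (cube (real n) x))) *
     indicator {\<omega>. Rsup R (cube (real n) x) \<omega> < ereal (real n)} \<omega>"
  using measure_restr[OF Lambda_lf[OF assms] cube_borel] by (simp add: good_weight_def)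

lemma R_measurable: "R y \<in> borel_measurable M"
  using stab unfolding stabilizing_def by blast

lemma measure_cube_measurable: "(\<lambda>\<omega>. measure (\<Lambda> \<omega>) (cube n x)) \<in> borel_measurable M"
  by (rule measurable_compose[OF L borel_measurable_measure_LFM[OF cube_borel]])

lemma Rsup_measurable: "Rsup R B \<in> borel_measurable M"
proof -
  have [measurable]: "(\<lambda>\<omega>. ereal (R y \<omega>)) \<in> borel_measurable M" for y
    using R_measurable by measurable
  have "countable (B \<inter> rat_points)" using countable_rat_points by (rule countable_subset[rotated]) auto
  then show ?thesis unfolding Rsup_def by measurable
qed

lemma good_weight_measurable: "good_weight \<Lambda> R l n x \<in> borel_measurable M"
proof -
  note [measurable] = measure_cube_measurable Rsup_measurable
  \<comment> \<open>The set in the original indicator is not cut down to \<open>space M\<close>; the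
    version that is defines an event and agrees on \<open>space M\<close>.\<close>
  have "(\<lambda>\<omega>. exp (- (l * measure (\<Lambda> \<omega>) (cube (real n) x))) *
     (indicator {\<omega>\<in>space M. Rsup R (cube (real n) x) \<omega> < ereal (real n)} \<omega> :: real)) \<in> borel_measurable M"
    by measurable
  also have "?this \<longleftrightarrow> ?thesis"
    by (rule measurable_cong) (simp add: good_weight_eq indicator_def)
  finally show ?thesis .
qed

text \<open>The weight at \<open>x\<close> is a fixed functional \<open>G\<close> of the pair of
  \<open>\<Lambda>\<close> and \<open>R\<close> shifted by \<open>x\<close>, and joint stationarity
  makes the law of that pair independent of the shift.\<close>

lemma expectation_good_weight:
  assumes x: "x \<in> rat_points"
  shows "expectation (good_weight \<Lambda> R l n x) = expectation (good_weight \<Lambda> R l n 0)"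
proof -
  let ?P = "LFM \<Otimes>\<^sub>M (\<Pi>\<^sub>M x\<in>UNIV. borel) :: ((real^'d) measure \<times> (real^'d \<Rightarrow> real)) measure"
  define G where "G p = exp (- (l * measure (fst p) (cube (real n) 0))) *
      indicator {p \<in> space ?P. (SUP y\<in>cube (real n) 0 \<inter> rat_points. ereal (snd p y)) < ereal (real n)} p"
    for p :: "(real^'d) measure \<times> (real^'d \<Rightarrow> real)"
  have G: "G \<in> borel_measurable ?P"
  proof -
    have [measurable]: "(\<lambda>p. measure (fst p) (cube (real n) 0)) \<in> borel_measurable ?P"
      by (rule measurable_compose[OF measurable_fst borel_measurable_measure_LFM[OF cube_borel]])
    have [measurable]: "(\<lambda>p. ereal (snd p y)) \<in> borel_measurable ?P" for y by measurable
    have [simp]: "countable (cube (real n) 0 \<inter> rat_points :: (real^'d) set)"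
      using countable_rat_points by (rule countable_subset[rotated]) auto
    have [measurable]: "(\<lambda>p. SUP y\<in>cube (real n) 0 \<inter> rat_points. ereal (snd p y)) \<in> borel_measurable ?P"
      by measurable
    show ?thesis unfolding G_def by measurable
  qed
  have shift_meas: "(\<lambda>\<omega>. (translate_measure x (\<Lambda> \<omega>), \<lambda>y. R (y + x) \<omega>)) \<in> measurable M ?P" for x
    by (intro measurable_Pair measurable_compose[OF L translate_measure_measurable]
        measurable_PiM_single' R_measurable) auto
  have meas: "(\<lambda>\<omega>. (\<Lambda> \<omega>, \<lambda>y. R y \<omega>)) \<in> measurable M ?P"
    by (intro measurable_Pair L measurable_PiM_single' R_measurable) auto
  have stat: "distr M ?P (\<lambda>\<omega>. (translate_measure x (\<Lambda> \<omega>), \<lambda>y. R (y + x) \<omega>))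
      = distr M ?P (\<lambda>\<omega>. (\<Lambda> \<omega>, \<lambda>y. R y \<omega>))"
    using stab unfolding stabilizing_def by blast
  have "good_weight \<Lambda> R l n x \<omega> = G (translate_measure x (\<Lambda> \<omega>), \<lambda>y. R (y + x) \<omega>)" if "\<omega> \<in> space M" for \<omega>
  proof -
    have "measure (translate_measure x (\<Lambda> \<omega>)) (cube (real n) 0) = measure (\<Lambda> \<omega>) (cube (real n) x)"
      using emeasure_translate[OF Lambda_lf[OF that] cube_borel, of x "real n" 0]
      by (simp add: measure_def translate_cube)
    moreover have "(SUP y\<in>cube (real n) 0 \<inter> rat_points. ereal (R (y + x) \<omega>)) = Rsup R (cube (real n) x) \<omega>"
      unfolding Rsup_def translate_cube_rat_points[OF x, symmetric] by (simp add: image_image)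
    ultimately show ?thesis
      using measurable_space[OF shift_meas that, of x] good_weight_eq[OF that]
      by (simp add: G_def indicator_def)
  qed
  then have "expectation (good_weight \<Lambda> R l n x)
      = expectation (\<lambda>\<omega>. G (translate_measure x (\<Lambda> \<omega>), \<lambda>y. R (y + x) \<omega>))"
    by (intro Bochner_Integration.integral_cong) auto
  also have "\<dots> = integral\<^sup>L (distr M ?P (\<lambda>\<omega>. (translate_measure x (\<Lambda> \<omega>), \<lambda>y. R (y + x) \<omega>))) G"
    by (rule integral_distr[OF shift_meas G, symmetric])
  also have "\<dots> = expectation (\<lambda>\<omega>. G (\<Lambda> \<omega>, \<lambda>y. R y \<omega>))"
    unfolding stat by (rule integral_distr[OF meas G])
  also have "\<dots> = expectation (good_weight \<Lambda> R l n 0)"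
  proof (intro Bochner_Integration.integral_cong refl)
    fix \<omega> assume \<omega>: "\<omega> \<in> space M"
    show "G (\<Lambda> \<omega>, \<lambda>y. R y \<omega>) = good_weight \<Lambda> R l n 0 \<omega>"
      using measurable_space[OF meas \<omega>] good_weight_eq[OF \<omega>]
      by (simp add: G_def indicator_def Rsup_def)
  qed
  finally show ?thesis .
qed

lemma good_weight_bounds:
  assumes "l \<ge> 0"
  shows "0 \<le> good_weight \<Lambda> R l n x \<omega>" "good_weight \<Lambda> R l n x \<omega> \<le> 1"
  using assms by (auto simp: good_weight_def indicator_def)

lemma good_weight_integrable:
  assumes "l \<ge> 0"
  shows "integrable M (good_weight \<Lambda> R l n x)"
  using good_weight_bounds[OF assms] good_weight_measurable
  by (intro integrable_const_bound[where B=1]) auto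

text \<open>Condition (ii) first yields a scale \<open>n\<close> at which the cube is good with
  probability above \<open>1 - \<epsilon>\<close>. With \<open>n\<close> fixed, the weight tends to
  the indicator of goodness as the intensity tends to 0.\<close>

lemma exists_good_scale:
  assumes "\<epsilon> > 0"
  shows "\<exists>n\<ge>1. r \<le> real n \<and> (\<exists>l0>0. expectation (good_weight \<Lambda> R l0 n 0) > 1 - \<epsilon>)"
proof -
  let ?A = "\<lambda>n. {\<omega> \<in> space M. Rsup R (cube (real n) 0) \<omega> < ereal (real n)}"
  have "(\<lambda>n. prob (?A n)) \<longlonglongrightarrow> 1"
    using stab unfolding stabilizing_def by blast
  then have "\<forall>\<^sub>F n in sequentially. prob (?A n) > 1 - \<epsilon>"
    by (rule order_tendstoD) (use assms in auto)
  moreover have "\<forall>\<^sub>F n in sequentially. n \<ge> max 1 (nat \<lceil>r\<rceil>)" by (rule eventually_ge_at_top)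
  ultimately have "\<forall>\<^sub>F n in sequentially. prob (?A n) > 1 - \<epsilon> \<and> n \<ge> max 1 (nat \<lceil>r\<rceil>)"
    by (rule eventually_conj)
  then obtain n where n: "prob (?A n) > 1 - \<epsilon>" "n \<ge> 1" "nat \<lceil>r\<rceil> \<le> n"
    unfolding eventually_sequentially by auto
  have A: "?A n \<in> events" using Rsup_measurable by measurable
  \<comment> \<open>Dominated convergence along the intensities \<open>1 / Suc k\<close>, with the
    weights bounded by 1.\<close>
  have "(\<lambda>k. expectation (good_weight \<Lambda> R (1 / real (Suc k)) n 0)) \<longlonglongrightarrow> expectation (indicator (?A n))"
  proof (rule integral_dominated_convergence[where w="\<lambda>_. 1"])
    show "AE \<omega> in M. (\<lambda>k. good_weight \<Lambda> R (1 / real (Suc k)) n 0 \<omega>) \<longlonglongrightarrow> indicator (?A n) \<omega>"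
    proof (rule AE_I2)
      fix \<omega> assume \<omega>: "\<omega> \<in> space M"
      let ?c = "measure (\<Lambda> \<omega>) (cube (real n) 0)"
      have "(\<lambda>k. 1 / real (Suc k)) \<longlonglongrightarrow> 0" using LIMSEQ_inverse_real_of_nat by (simp add: inverse_eq_divide)
      then have "(\<lambda>k. exp (- (1 / real (Suc k) * ?c)) * (indicator (?A n) \<omega> :: real))
          \<longlonglongrightarrow> exp (- (0 * ?c)) * indicator (?A n) \<omega>"
        by (intro tendsto_intros)
      then show "(\<lambda>k. good_weight \<Lambda> R (1 / real (Suc k)) n 0 \<omega>) \<longlonglongrightarrow> indicator (?A n) \<omega>"
        using \<omega> by (simp add: good_weight_eq indicator_def)
    qed
    show "AE \<omega> in M. norm (good_weight \<Lambda> R (1 / real (Suc k)) n 0 \<omega>) \<le> 1" for k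
      using good_weight_bounds[of "1 / real (Suc k)"] by simp
  qed (use A good_weight_measurable in auto)
  also have "expectation (indicator (?A n)) = prob (?A n)" using A by simp
  finally have "\<forall>\<^sub>F k in sequentially. expectation (good_weight \<Lambda> R (1 / real (Suc k)) n 0) > 1 - \<epsilon>"
    by (rule order_tendstoD) (use n in auto)
  then obtain k where "expectation (good_weight \<Lambda> R (1 / real (Suc k)) n 0) > 1 - \<epsilon>"
    unfolding eventually_sequentially by auto
  moreover have "1 / real (Suc k) > 0" by simp
  moreover have "r \<le> real n" using n(3) by linarith
  ultimately show ?thesis using n(2) by blast
qed

text \<open>Lets an estimate at one intensity serve all smaller ones.\<close>

lemma expectation_good_weight_antimono:
  assumes "0 \<le> l" "l \<le> l'"
  shows "expectation (good_weight \<Lambda> R l' n x) \<le> expectation (good_weight \<Lambda> R l n x)"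
proof (rule integral_mono)
  fix \<omega> assume "\<omega> \<in> space M"
  then show "good_weight \<Lambda> R l' n x \<omega> \<le> good_weight \<Lambda> R l n x \<omega>"
    using assms by (auto simp: good_weight_def indicator_def intro!: mult_right_mono)
qed (use assms good_weight_integrable in auto)

text \<open>Nothing is known about the joint law of \<open>R\<close> and \<open>X\<close>.  The occupation probability is therefore
  first written in terms of \<open>\<Lambda>\<close> alone, and \<open>R\<close> enters only through the pointwise bound
  \<open>1 - exp (- l \<Lambda>(Q)) \<le> 1 - good_weight\<close>.\<close>
lemma occupation_probability_le:
  assumes cox: "cox_process M \<Lambda> l X" and l: "l \<ge> 0" and n: "n \<ge> 1"
    and fin: "finite \<phi>" and rat: "\<phi> \<subseteq> rat_points"
    and dist: "\<And>x y. x \<in> \<phi> \<Longrightarrow> y \<in> \<phi> \<Longrightarrow> x \<noteq> y \<Longrightarrow> dist x y > 3 * real n"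
    and disj: "disjoint_family_on (cube (real n)) \<phi>"
  shows "prob {\<omega> \<in> space M. \<forall>x\<in>\<phi>. pcount (X \<omega>) (cube (real n) x) \<noteq> 0}
    \<le> (1 - expectation (good_weight \<Lambda> R l n 0)) ^ card \<phi>"
proof -
  have "(\<lambda>\<mu>. exp (- (l * measure \<mu> UNIV))) \<in> borel_measurable LFM"
    using borel_measurable_measure_LFM[of UNIV] by measurable
  \<comment> \<open>The function to which condition (iii) is applied; the bound 1 comes from
    \<open>l \<ge> 0\<close>.\<close>
  then have f: "(\<lambda>\<mu>. exp (- (l * measure \<mu> UNIV))) \<in> borel_measurable LFM \<and>
      (\<forall>\<mu>\<in>space LFM. 0 \<le> exp (- (l * measure \<mu> UNIV))) \<and>
      (\<exists>c. \<forall>\<mu>\<in>space LFM. exp (- (l * measure \<mu> UNIV)) \<le> c) \<and>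
      finite \<phi> \<and> (\<forall>x\<in>\<phi>. \<forall>y\<in>\<phi>. x \<noteq> y \<longrightarrow> dist x y > 3 * real n)"
    using l fin dist by (auto intro!: exI[of _ 1])
  have "indep_vars (\<lambda>_. borel) (good_weight \<Lambda> R l n) \<phi>"
    unfolding good_weight_def[abs_def]
    using stab[unfolded stabilizing_def, THEN conjunct2, THEN conjunct2, THEN conjunct2, THEN spec,
        THEN mp, OF n, THEN spec, THEN spec, THEN mp, OF f] .
  then have indep: "indep_vars (\<lambda>_. borel) (\<lambda>x \<omega>. 1 - good_weight \<Lambda> R l n x \<omega>) \<phi>"
    by (rule indep_vars_compose2) measurable
  have int: "integrable M (\<lambda>\<omega>. 1 - good_weight \<Lambda> R l n x \<omega>)" for x
    using good_weight_integrable[OF l] by auto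
  have "prob {\<omega> \<in> space M. \<forall>x\<in>\<phi>. pcount (X \<omega>) (cube (real n) x) \<noteq> 0}
      = expectation (\<lambda>\<omega>. \<Prod>x\<in>\<phi>. 1 - exp (- (l * measure (\<Lambda> \<omega>) (cube (real n) x))))"
    using cox_occupation_probability[OF L cox l, of "{}" \<phi> "cube (real n)"] fin disj
    by (simp add: cube_borel bounded_cube)
  also have "\<dots> \<le> expectation (\<lambda>\<omega>. \<Prod>x\<in>\<phi>. 1 - good_weight \<Lambda> R l n x \<omega>)"
  proof (rule integral_mono)
    show "integrable M (\<lambda>\<omega>. \<Prod>x\<in>\<phi>. 1 - good_weight \<Lambda> R l n x \<omega>)"
      by (rule indep_vars_integrable[OF fin indep int])
    show "integrable M (\<lambda>\<omega>. \<Prod>x\<in>\<phi>. 1 - exp (- (l * measure (\<Lambda> \<omega>) (cube (real n) x))))"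
    proof (rule integrable_const_bound[where B=1])
      show "AE \<omega> in M. norm (\<Prod>x\<in>\<phi>. 1 - exp (- (l * measure (\<Lambda> \<omega>) (cube (real n) x)))) \<le> 1"
        using l by (auto simp: abs_prod intro!: prod_le_1)
    qed (use measure_cube_measurable in measurable)
    \<comment> \<open>On a good cube both factors agree; otherwise the right one is 1.\<close>
    show "(\<Prod>x\<in>\<phi>. 1 - exp (- (l * measure (\<Lambda> \<omega>) (cube (real n) x))))
        \<le> (\<Prod>x\<in>\<phi>. 1 - good_weight \<Lambda> R l n x \<omega>)" if "\<omega> \<in> space M" for \<omega>
      using l by (intro prod_mono) (auto simp: good_weight_eq[OF that] indicator_def)
  qed
  also have "\<dots> = (\<Prod>x\<in>\<phi>. expectation (\<lambda>\<omega>. 1 - good_weight \<Lambda> R l n x \<omega>))"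
    by (rule indep_vars_lebesgue_integral[OF fin indep int])
  \<comment> \<open>Stationarity gives all factors the mean at the origin, the points of
    \<open>\<phi>\<close> being rational.\<close>
  also have "\<dots> = (\<Prod>x\<in>\<phi>. 1 - expectation (good_weight \<Lambda> R l n 0))"
    using good_weight_integrable[OF l] rat
    by (intro prod.cong refl) (subst Bochner_Integration.integral_diff; auto simp: prob_space expectation_good_weight)
  finally show ?thesis by simp
qed

end

end

section \<open>Absence of percolation\<close>

text \<open>Finiteness matters: a sum over an infinite set is 0 by convention.\<close>

lemma pcount_nonzero:
  assumes "finite {x \<in> B. \<phi> x > 0}" "{x. \<phi> x > 0} \<inter> B \<noteq> {}"
  shows "pcount \<phi> B \<noteq> 0"
  using assms by (auto simp: pcount_def)

lemma inj_site: "n \<ge> 1 \<Longrightarrow> inj (site n)"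
  by (auto simp: inj_def site_def vec_eq_iff)

theorem mainTheorem1:
  fixes M :: "'w measure" and \<Lambda> :: "'w \<Rightarrow> (real^'d) measure"
    and R :: "real^'d \<Rightarrow> 'w \<Rightarrow> real" and r :: real
  assumes "prob_space M"
    and "\<Lambda> \<in> measurable M LFM"
    and "stationary_rm M \<Lambda>"
    and "(\<integral>\<^sup>+\<omega>. emeasure (\<Lambda> \<omega>) unit_cube \<partial>M) = 1"
    and "stabilizing M \<Lambda> R"
    and "r > 0"
  shows "critical_intensity M \<Lambda> r > 0"
proof -
  interpret prob_space M by fact
  note L = assms(2) and stab = assms(5)
  define b where "b = card (steps :: (int^'d) set)"
  define K where "K = card (residue_classes :: (int^'d) set)"
  \<comment> \<open>Chosen so that \<open>b * q = 1 / 2\<close>, against at most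
    \<open>b ^ m\<close> paths.\<close>
  define q where "q = 1 / (2 * real b)"
  have b: "b > 0" unfolding b_def by (rule card_steps_pos)
  then have q: "0 < q" "q \<le> 1" by (auto simp: q_def)
  \<comment> \<open>A separated subset keeps at least a fraction \<open>1 / K\<close> of the sites,
    so a bound \<open>q ^ K\<close> per separated cell amounts to \<open>q\<close> per site.\<close>
  have "q ^ K > 0" using q by simp
  from exists_good_scale[OF L stab this, of r] obtain n l0 where n: "n \<ge> 1" "r \<le> real n"
    and l0: "l0 > 0" "expectation (good_weight \<Lambda> R l0 n 0) > 1 - q ^ K" by auto
  have subcritical: "prob {\<omega> \<in> space M. percolates {x. X \<omega> x > 0} r} = 0"
    if l: "0 < l" "l < l0" and cox: "cox_process M \<Lambda> l X" for l X
  \<comment> \<open>Percolation is not shown to be an event. If it is not one, its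
    \<open>measure\<close> is 0 by convention, and \<open>critical_intensity\<close> reads it the
    same way.\<close>
  proof (cases "{\<omega> \<in> space M. percolates {x. X \<omega> x > 0} r} \<in> events")
    case False
    then show ?thesis by (rule measure_notin_sets)
  next
    case True
    define p where "p = 1 - expectation (good_weight \<Lambda> R l n 0)"
    have p: "0 \<le> p" "p \<le> q ^ K"
      using expectation_good_weight_antimono[OF L stab, of l l0 n 0] l l0
        integral_mono[OF good_weight_integrable[OF L stab, of l n 0] integrable_const[of 1]]
        good_weight_bounds(2)[OF L stab, of l n 0]
      by (auto simp: p_def prob_space)
    let ?O = "\<lambda>S. {\<omega> \<in> space M. \<forall>y\<in>S. pcount (X \<omega>) (cell n y) \<noteq> 0}"
    have O: "?O S \<in> events" if "finite S" for S
    proof (rule sets.sets_Collect_finite_All[OF _ that])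
      fix y
      have [measurable]: "(\<lambda>\<omega>. pcount (X \<omega>) (cell n y)) \<in> measurable M (count_space UNIV)"
        using cox[unfolded cox_process_def, THEN conjunct2, THEN conjunct1, rule_format, of "cell n y"]
          cube_borel bounded_cube unfolding cell_def by auto
      show "{\<omega> \<in> space M. pcount (X \<omega>) (cell n y) \<noteq> 0} \<in> events" by measurable
    qed
    have prob_O: "prob (?O S) \<le> q ^ card S" if S: "finite S" for S
    proof -
      obtain T where T: "T \<subseteq> S" "card S \<le> K * card T"
        and sep: "\<And>x y. x \<in> T \<Longrightarrow> y \<in> T \<Longrightarrow> x \<noteq> y \<Longrightarrow> \<exists>i. \<bar>x $ i - y $ i\<bar> \<ge> 4"
        using exists_separated_subset[OF S] unfolding K_def by metis
      have "finite T" using T S finite_subset by blast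
      \<comment> \<open>Forgetting the sites outside \<open>T\<close> only enlarges the event and
        leaves cells far enough apart for independence.\<close>
      have "prob (?O S) \<le> prob (?O T)"
        using T by (intro finite_measure_mono O \<open>finite T\<close>) auto
      also have "?O T = {\<omega> \<in> space M. \<forall>x\<in>site n ` T. pcount (X \<omega>) (cube (real n) x) \<noteq> 0}"
        by (auto simp: cell_def)
      also have "prob \<dots> \<le> p ^ card (site n ` T)"
        unfolding p_def
      proof (rule occupation_probability_le[OF L stab cox _ n(1)])
        show "dist x y > 3 * real n" if "x \<in> site n ` T" "y \<in> site n ` T" "x \<noteq> y" for x y
          using that sep separated_cells(1)[OF n(1)] by blast
        have "cube (real n) (site n x) \<inter> cube (real n) (site n y) = {}"
          if "x \<in> T" "y \<in> T" "site n x \<noteq> site n y" for x y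
          using that sep separated_cells(2)[OF n(1), of x _ y] unfolding cell_def by metis
        then show "disjoint_family_on (cube (real n)) (site n ` T)"
          unfolding disjoint_family_on_def by blast
      qed (use l \<open>finite T\<close> site_rat_points in auto)
      also have "card (site n ` T) = card T"
        using inj_site[OF n(1)] by (intro card_image) (auto intro: inj_on_subset)
      also have "p ^ card T \<le> (q ^ K) ^ card T" using p by (intro power_mono)
      also have "\<dots> = q ^ (K * card T)" by (simp add: power_mult)
      also have "\<dots> \<le> q ^ card S" using q T by (intro power_decreasing) auto
      finally show ?thesis .
    qed
    define G where "G z m = (\<Union>S\<in>saw_sets z m. ?O S)" for z m
    have G: "G z m \<in> events" for z m
      unfolding G_def using finite_saw_sets saw_sets_card(1) by (intro sets.finite_UN O) auto
    \<comment> \<open>Union bound over the paths. Each has \<open>m + 1\<close> sites, and one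
      factor \<open>q\<close> is given up.\<close>
    have prob_G: "prob (G z m) \<le> (1 / 2) ^ m" for z m
    proof -
      have "prob (G z m) \<le> (\<Sum>S\<in>saw_sets z m. prob (?O S))"
        unfolding G_def using saw_sets_card(1) O
        by (intro finite_measure_subadditive_finite finite_saw_sets) auto
      also have "\<dots> \<le> (\<Sum>S\<in>saw_sets z m. q ^ m)"
      proof (rule sum_mono)
        fix S assume S: "S \<in> saw_sets z m"
        have "prob (?O S) \<le> q ^ card S" by (rule prob_O[OF saw_sets_card(1)[OF S]])
        also have "\<dots> \<le> q ^ m" using saw_sets_card(2)[OF S] q by (intro power_decreasing) auto
        finally show "prob (?O S) \<le> q ^ m" .
      qed
      also have "\<dots> = real (card (saw_sets z m)) * q ^ m" by simp
      also have "\<dots> \<le> real (b ^ m) * q ^ m"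
        using card_saw_sets[of z m] q unfolding b_def by (intro mult_right_mono of_nat_mono) auto
      also have "\<dots> = (real b * q) ^ m" by (simp add: power_mult_distrib)
      also have "real b * q = 1 / 2" using b by (simp add: q_def)
      finally show ?thesis .
    qed
    have "(\<Inter>m. G z m) \<in> null_sets M" for z
    proof (rule null_setsI)
      show I: "(\<Inter>m. G z m) \<in> events" using G by auto
      have "prob (\<Inter>m. G z m) \<le> (1 / 2) ^ m" for m
        using finite_measure_mono[OF _ G, of "\<Inter>m. G z m" z m] prob_G[of z m] by (auto intro: order_trans)
      then have "prob (\<Inter>m. G z m) \<le> 0"
        by (intro LIMSEQ_le_const[OF LIMSEQ_realpow_zero[of "1 / 2 :: real"]]) auto
      then show "emeasure M (\<Inter>m. G z m) = 0"
        by (simp add: emeasure_eq_measure measure_le_0_iff)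
    qed
    \<comment> \<open>There are only countably many starting cells, so the random choice of
      \<open>z\<close> is harmless.\<close>
    then have "(\<Union>z. \<Inter>m. G z m) \<in> null_sets M" by (intro null_sets_UN) auto
    moreover have "{\<omega> \<in> space M. percolates {x. X \<omega> x > 0} r} \<subseteq> (\<Union>z. \<Inter>m. G z m)"
    proof
      fix \<omega> assume "\<omega> \<in> {\<omega> \<in> space M. percolates {x. X \<omega> x > 0} r}"
      then have \<omega>: "\<omega> \<in> space M" "percolates {x. X \<omega> x > 0} r" by auto
      have fin: "finite {x \<in> B. X \<omega> x > 0}" if "bounded B" for B
        using cox \<omega>(1) that unfolding cox_process_def by blast
      then have "finite ({x. X \<omega> x > 0} \<inter> B)" if "bounded B" for B
        using that by (simp add: Collect_conj_eq Int_commute)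
      from percolates_imp_occupied_saw[OF this n \<omega>(2)] obtain z where
        z: "\<And>m. \<exists>S\<in>saw_sets z m. \<forall>y\<in>S. {x. X \<omega> x > 0} \<inter> cell n y \<noteq> {}" by auto
      have occ: "pcount (X \<omega>) (cell n y) \<noteq> 0" if "{x. X \<omega> x > 0} \<inter> cell n y \<noteq> {}" for y
        using that fin[of "cell n y"] bounded_cube unfolding cell_def by (intro pcount_nonzero) auto
      have "\<omega> \<in> G z m" for m
      proof -
        obtain S where S: "S \<in> saw_sets z m" "\<forall>y\<in>S. {x. X \<omega> x > 0} \<inter> cell n y \<noteq> {}"
          using z[of m] by (elim bexE)
        have "\<omega> \<in> ?O S" using \<omega>(1) occ S(2) by (intro CollectI conjI ballI) auto
        then show ?thesis unfolding G_def by (rule UN_I[OF S(1)])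
      qed
      then show "\<omega> \<in> (\<Union>z. \<Inter>m. G z m)" by blast
    qed
    ultimately have "{\<omega> \<in> space M. percolates {x. X \<omega> x > 0} r} \<in> null_sets M"
      using True null_sets_subset by blast
    then show ?thesis by (simp add: measure_eq_0_null_sets)
  qed
  have "ereal l0 \<le> critical_intensity M \<Lambda> r"
    unfolding critical_intensity_def
  proof (rule Inf_greatest)
    fix s assume "s \<in> {ereal l | l. l > 0 \<and> (\<exists>X. cox_process M \<Lambda> l X \<and>
        measure M {\<omega> \<in> space M. percolates {x. X \<omega> x > 0} r} > 0)}"
    then obtain l X where "s = ereal l" "l > 0" "cox_process M \<Lambda> l X"
      "measure M {\<omega> \<in> space M. percolates {x. X \<omega> x > 0} r} > 0" by auto
    then show "ereal l0 \<le> s" using subcritical[of l X] by (cases "l < l0") auto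
  qed
  then show ?thesis using l0(1) by (auto intro: less_le_trans[of _ "ereal l0"])
qed

end
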